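(* Let $T=\begin{bmatrix}A&C\\ 0&B\end{bmatrix}\in\mathcal L(\mathcal H_1\oplus\mathcal H_2)$ with $\dim\mathcal H_1=\dim\mathcal H_2=\aleph_0$ and $A$ similar to the simple unilateral shift $S$, and let $\widehat T$, $\mu_0$, $\{\mu_k\}_{k\ge1}$ and the cross-sections $\mathcal L_{*,r}$ $(r\in\mathbb N)$ be as described in the context. Then $T$ has a nontrivial hyperinvariant subspace in each of the following cases: (i) for some $r\in\mathbb N$ the subspace $\mathcal L=\mathcal L_{*,r}$ satisfies one of: (D1) $\dim\mathcal L=6$; (D2) $\dim\mathcal L<5$; (D3) $\dim\mathcal L=5$ and $\dim(\mathcal L\cap\mathcal M_3)>2$; (ii) for every $r\in\mathbb N$ one has (D4): $\dim\mathcal L_{*,r}=5$ and $\dim(\mathcal L_{*,r}\cap\mathcal M_3)=2$; and for some $r\in\mathbb N$ the canonical basis $(L_1,L_2)$ of $\mathcal L_{*,r}\cap\mathcal M_3$ is not of the form $(E7_0)$ with respect to $\Delta_r=\mathrm{diag}(\mu_r,\mu_{r+1},\mu_{r+2})$. More precisely, in these cases there exists $0\ne x\in\mathcal H_1$ such that $\{T\}'x$ is not dense in $\mathcal H_1\oplus\mathcal H_2$, and so its closure is a proper hyperinvariant subspace of $T$.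
   Context: All Hilbert spaces are complex; $\mathcal L(\mathcal H)$ is the algebra of bounded linear operators on $\mathcal H$; $\{T\}'$ is the commutant of $T$. A hyperinvariant subspace of $T$ is a closed subspace invariant for every $Q\in\{T\}'$; it is nontrivial if it is neither $\{0\}$ nor the whole space. $\mathcal H_1$ is identified with $\mathcal H_1\oplus\{0\}$. Model. $\mathcal H$ is a Hilbert space with orthonormal basis $\{e_k\}_{k=1}^\infty$, $(e\otimes f)h=\langle h,f\rangle e$, $S=\sum_{k\ge1}e_{k+1}\otimes e_k$ is the simple unilateral shift. $V:\mathcal H\to\mathcal H_1$ is bounded and invertible with $VS=AV$. $\mu_0\in\partial\sigma(B)$, and $\{\mu_k\}_{k\ge1}$ is a sequence of distinct nonzero complex numbers in the resolvent set of $B$ converging to $\mu_0$ (fast enough) such that $B-\mu_0I$ is similar to an operator $\widehat B=\begin{bmatrix}*&*\\ F_*&D_*\end{bmatrix}\in\mathcal L(\mathcal H\oplus\mathcal H)$, where $D_*=\sum_{k\ge1}(\mu_k-\mu_0)e_k\otimes e_k$ and $\operatorname{rank}F_*=1$; $W:\mathcal H\oplus\mathcal H\to\mathcal H_2$ is bounded and invertible with $W\widehat B=(B-\mu_0I)W$. With $Z=V\oplus W$ put $\widehat T=Z^{-1}(T-\mu_0I)Z=\begin{bmatrix}S-\mu_0I&V^{-1}CW\\ 0&\widehat B\end{bmatrix}\in\mathcal L(\mathcal H\oplus\mathcal H\oplus\mathcal H)$. Operators $Q\in\{\widehat T\}'$ are written as $3\times3$ operator matrices $[Q_{i,j}]$,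 and $\mathcal L_{3,1}=\{Q_{3,1}:Q\in\{\widehat T\}'\}\subset\mathcal L(\mathcal H)$. Cross-sections. For $r\in\mathbb N$ let $\mathcal E_{3,r}$ be the span of $e_r,e_{r+1},e_{r+2}$, let $P_{\mathcal E_{3,r}}$ be the orthogonal projection onto it, and $\mathcal L_{*,r}=\{P_{\mathcal E_{3,r}}X|_{\mathcal E_{3,r}}:X\in\mathcal L_{3,1}\}$, identified with a subspace of the $3\times3$ complex matrices $M_3[\mathbb C]$ via the ordered basis $(e_r,e_{r+1},e_{r+2})$. $\mathcal M_3$ is the subspace of matrices in $M_3[\mathbb C]$ whose third column is zero. Canonical basis. Order pairs $(i,j)$, $i\in\{1,2,3\}$, $j\in\{1,2\}$, lexicographically ($\prec$). Each 2-dimensional subspace $\mathcal L_0\subset\mathcal M_3$ has a unique canonical basis $(L_1,L_2)$, $L_k=[l^k_{i,j}]$, for which there are (unique) pairs $(i_1,j_1)\prec(i_2,j_2)$ with $l^k_{i_r,j_r}=\delta_{k,r}$ for $k,r\in\{1,2\}$ and $l^k_{i,j}=0$ whenever $(i,j)\prec(i_k,j_k)$. For $\Delta=\mathrm{diag}(b_1,b_2,b_3)$ with $b_1,b_2,b_3$ distinct and nonzero, put $b_\Delta(2)=\frac1{b_3}-\frac1{b_1}$ and $b_\Delta(3)=\frac1{b_2}-\frac1{b_1}$. The pair $(L_1,L_2)$ is of the form $(E7_0)$ with respect to $\Delta$ if there are $x,y\in\mathbb C$ with $xy\ne0$ and $$L_1=\begin{bmatrix}1&0&0\\ x&0&0\\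 y&0&0\end{bmatrix},\qquad L_2=\begin{bmatrix}0&1&0\\ b_\Delta(3)x&x&0\\ b_\Delta(2)y&y&0\end{bmatrix}.$$ *)

theory Defs
  imports "HOL-Analysis.Analysis"
begin

section \<open>Complex Hilbert spaces\<close>

text \<open>The class extends the real one, so that the norm, the topology and \<^const>\<open>bounded_linear\<close> of
  the library apply. By \<open>inner_eq_Re_cinner\<close> the norm is the one given by the complex inner
  product, which is linear in its first argument.\<close>

class complex_hilbert = real_inner + complete_space +
  fixes scaleC :: "complex \<Rightarrow> 'a \<Rightarrow> 'a"  (infixr "*\<^sub>C" 75)
    and cinner :: "'a \<Rightarrow> 'a \<Rightarrow> complex"
  assumes scaleC_add_right: "c *\<^sub>C (x + y) = c *\<^sub>C x + c *\<^sub>C y"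
    and scaleC_add_left: "(c + d) *\<^sub>C x = c *\<^sub>C x + d *\<^sub>C x"
    and scaleC_scaleC: "c *\<^sub>C d *\<^sub>C x = (c * d) *\<^sub>C x"
    and scaleC_one: "1 *\<^sub>C x = x"
    and scaleR_eq_scaleC: "r *\<^sub>R x = complex_of_real r *\<^sub>C x"
    and cinner_commute: "cinner x y = cnj (cinner y x)"
    and cinner_add_left: "cinner (x + y) z = cinner x z + cinner y z"
    and cinner_scaleC_left: "cinner (c *\<^sub>C x) y = c * cinner x y"
    and inner_eq_Re_cinner: "inner x y = Re (cinner x y)"

instantiation complex :: complex_hilbert
begin

definition scaleC_complex :: "complex \<Rightarrow> complex \<Rightarrow> complex"
  where "scaleC_complex c x = c * x"

definition cinner_complex :: "complex \<Rightarrow> complex \<Rightarrow> complex"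
  where "cinner_complex x y = x * cnj y"

instance
  by standard
    (simp_all add: scaleC_complex_def cinner_complex_def inner_complex_def algebra_simps
      scaleR_conv_of_real)

end

instantiation prod :: (complex_hilbert, complex_hilbert) complex_hilbert
begin

definition scaleC_prod :: "complex \<Rightarrow> 'a \<times> 'b \<Rightarrow> 'a \<times> 'b"
  where "scaleC_prod c p = (c *\<^sub>C fst p, c *\<^sub>C snd p)"

definition cinner_prod :: "'a \<times> 'b \<Rightarrow> 'a \<times> 'b \<Rightarrow> complex"
  where "cinner_prod p q = cinner (fst p) (fst q) + cinner (snd p) (snd q)"

instance
proof
  show "cinner p q = cnj (cinner q p)" for p q :: "'a \<times> 'b"
    unfolding cinner_prod_def
    by (metis cinner_commute complex_cnj_add)
qed (simp_all add: scaleC_prod_def cinner_prod_def inner_prod_def scaleC_add_right scaleC_add_left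
      scaleC_scaleC scaleC_one scaleR_eq_scaleC cinner_add_left cinner_scaleC_left
      inner_eq_Re_cinner algebra_simps prod_eq_iff)

end

instantiation vec :: (complex_hilbert, finite) complex_hilbert
begin

definition scaleC_vec :: "complex \<Rightarrow> 'a ^ 'b \<Rightarrow> 'a ^ 'b"
  where "scaleC_vec c v = (\<chi> i. c *\<^sub>C (v $ i))"

definition cinner_vec :: "'a ^ 'b \<Rightarrow> 'a ^ 'b \<Rightarrow> complex"
  where "cinner_vec v w = (\<Sum>i\<in>UNIV. cinner (v $ i) (w $ i))"

instance
proof
  show "cinner v w = cnj (cinner w v)" for v w :: "'a ^ 'b"
    unfolding cinner_vec_def cnj_sum
    by (intro sum.cong refl cinner_commute)
qed (simp_all add: scaleC_vec_def cinner_vec_def inner_vec_def scaleC_add_right scaleC_add_left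
      scaleC_scaleC scaleC_one scaleR_eq_scaleC cinner_add_left cinner_scaleC_left
      inner_eq_Re_cinner algebra_simps vec_eq_iff sum.distrib sum_distrib_left)

end

global_interpretation complex_vector:
  vector_space "scaleC :: complex \<Rightarrow> 'a \<Rightarrow> 'a :: complex_hilbert"
  defines csubspace = complex_vector.subspace
    and cspan = complex_vector.span
    and cdependent = complex_vector.dependent
    and cdim = complex_vector.dim
  by standard (simp_all add: scaleC_add_right scaleC_add_left scaleC_scaleC scaleC_one)

definition orthonormal_basis :: "(nat \<Rightarrow> 'a :: complex_hilbert) \<Rightarrow> bool"
  where "orthonormal_basis e \<longleftrightarrow>
    (\<forall>i j. cinner (e i) (e j) = (if i = j then 1 else 0)) \<and> closure (cspan (range e)) = UNIV"

definition hilbert_dim_aleph0 :: "'a :: complex_hilbert itself \<Rightarrow> bool"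
  where "hilbert_dim_aleph0 _ \<longleftrightarrow> (\<exists>e :: nat \<Rightarrow> 'a. orthonormal_basis e)"


section \<open>Bounded operators and hyperinvariant subspaces\<close>

definition bounded_clinear :: "('a :: complex_hilbert \<Rightarrow> 'b :: complex_hilbert) \<Rightarrow> bool"
  where "bounded_clinear f \<longleftrightarrow> bounded_linear f \<and> (\<forall>c x. f (c *\<^sub>C x) = c *\<^sub>C f x)"

definition bounded_invertible :: "('a :: complex_hilbert \<Rightarrow> 'b :: complex_hilbert) \<Rightarrow> bool"
  where "bounded_invertible f \<longleftrightarrow>
    bounded_clinear f \<and> (\<exists>g. bounded_clinear g \<and> g \<circ> f = id \<and> f \<circ> g = id)"

definition shift_by :: "('a :: complex_hilbert \<Rightarrow> 'a) \<Rightarrow> complex \<Rightarrow> 'a \<Rightarrow> 'a"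
  where "shift_by T z = (\<lambda>x. T x - z *\<^sub>C x)"

definition resolvent_set :: "('a :: complex_hilbert \<Rightarrow> 'a) \<Rightarrow> complex set"
  where "resolvent_set T = {z. bounded_invertible (shift_by T z)}"

definition spectrum :: "('a :: complex_hilbert \<Rightarrow> 'a) \<Rightarrow> complex set"
  where "spectrum T = - resolvent_set T"

definition commutant :: "('a :: complex_hilbert \<Rightarrow> 'a) \<Rightarrow> ('a \<Rightarrow> 'a) set"
  where "commutant T = {Q. bounded_clinear Q \<and> Q \<circ> T = T \<circ> Q}"

definition hyperinvariant :: "('a :: complex_hilbert \<Rightarrow> 'a) \<Rightarrow> 'a set \<Rightarrow> bool"
  where "hyperinvariant T M \<longleftrightarrow> csubspace M \<and> closed M \<and> (\<forall>Q\<in>commutant T. Q ` M \<subseteq> M)"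

definition nontrivial_hyperinvariant :: "('a :: complex_hilbert \<Rightarrow> 'a) \<Rightarrow> 'a set \<Rightarrow> bool"
  where "nontrivial_hyperinvariant T M \<longleftrightarrow> hyperinvariant T M \<and> M \<noteq> {0} \<and> M \<noteq> UNIV"

definition commutant_orbit :: "('a :: complex_hilbert \<Rightarrow> 'a) \<Rightarrow> 'a \<Rightarrow> 'a set"
  where "commutant_orbit T x = {Q x | Q. Q \<in> commutant T}"

text \<open>The operator with matrix \<open>[a b; c d]\<close> on an orthogonal sum of two spaces.\<close>

definition block_op :: "('a \<Rightarrow> 'c) \<Rightarrow> ('b \<Rightarrow> 'c) \<Rightarrow> ('a \<Rightarrow> 'd) \<Rightarrow> ('b \<Rightarrow> 'd) \<Rightarrow> 'a \<times> 'b \<Rightarrow>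
    'c :: complex_hilbert \<times> 'd :: complex_hilbert"
  where "block_op a b c d = (\<lambda>(x, y). (a x + b y, c x + d y))"


section \<open>The model operator\<close>

text \<open>Throughout, basis vectors and the points \<open>\<mu>\<^sub>k\<close> are indexed from 0: \<open>e k\<close> stands for
  \<open>e\<^sub>k\<^sub>+\<^sub>1\<close> and \<open>\<mu> k\<close> for \<open>\<mu>\<^sub>k\<^sub>+\<^sub>1\<close>, where \<open>k \<ge> 0\<close>. The limit \<open>\<mu>\<^sub>0\<close> is a
  separate variable \<open>\<mu>0\<close>. Infinite sums of operators converge strongly.\<close>

definition rank_one :: "'a :: complex_hilbert \<Rightarrow> 'a \<Rightarrow> 'a \<Rightarrow> 'a"
  where "rank_one e f = (\<lambda>h. cinner h f *\<^sub>C e)"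

definition unilateral_shift :: "(nat \<Rightarrow> 'a :: complex_hilbert) \<Rightarrow> 'a \<Rightarrow> 'a"
  where "unilateral_shift e = (\<lambda>h. \<Sum>k. rank_one (e (Suc k)) (e k) h)"

definition diagonal_op :: "(nat \<Rightarrow> 'a :: complex_hilbert) \<Rightarrow> (nat \<Rightarrow> complex) \<Rightarrow> 'a \<Rightarrow> 'a"
  where "diagonal_op e d = (\<lambda>h. \<Sum>k. d k *\<^sub>C rank_one (e k) (e k) h)"

definition model_op :: "('a :: complex_hilbert \<Rightarrow> 'b :: complex_hilbert) \<Rightarrow> ('b \<Rightarrow> 'b) \<Rightarrow> complex \<Rightarrow> 'a \<Rightarrow> 'a"
  where "model_op Z T \<mu>0 = inv Z \<circ> shift_by T \<mu>0 \<circ> Z"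

definition entry31 :: "('a :: complex_hilbert \<times> 'a \<times> 'a \<Rightarrow> 'a \<times> 'a \<times> 'a) \<Rightarrow> 'a \<Rightarrow> 'a"
  where "entry31 Q = (\<lambda>x. snd (snd (Q (x, 0, 0))))"

definition L31 :: "('a :: complex_hilbert \<times> 'a \<times> 'a \<Rightarrow> 'a \<times> 'a \<times> 'a) \<Rightarrow> ('a \<Rightarrow> 'a) set"
  where "L31 That = entry31 ` commutant That"


section \<open>Cross-sections\<close>

text \<open>In the type \<open>3\<close> the numeral \<open>3\<close> equals \<open>0\<close> and is the least element of the library order.
  The map \<open>off\<close> sends the indices 1, 2, 3 to 0, 1, 2 and carries the intended order.\<close>

definition off :: "3 \<Rightarrow> nat"
  where "off i = (if i = 1 then 0 else if i = 2 then 1 else 2)"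

definition proj3 :: "(nat \<Rightarrow> 'a :: complex_hilbert) \<Rightarrow> nat \<Rightarrow> 'a \<Rightarrow> 'a"
  where "proj3 e r = (\<lambda>h. \<Sum>k = r..r + 2. rank_one (e k) (e k) h)"

definition compression_matrix ::
    "(nat \<Rightarrow> 'a :: complex_hilbert) \<Rightarrow> nat \<Rightarrow> ('a \<Rightarrow> 'a) \<Rightarrow> complex ^ 3 ^ 3"
  where "compression_matrix e r X =
    (\<chi> i j. cinner (proj3 e r (X (e (r + off j)))) (e (r + off i)))"

definition cross_section ::
    "(nat \<Rightarrow> 'a :: complex_hilbert) \<Rightarrow> ('a \<times> 'a \<times> 'a \<Rightarrow> 'a \<times> 'a \<times> 'a) \<Rightarrow> nat \<Rightarrow> (complex ^ 3 ^ 3) set"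
  where "cross_section e That r = compression_matrix e r ` L31 That"

definition M3 :: "(complex ^ 3 ^ 3) set"
  where "M3 = {M. \<forall>i. M $ i $ 3 = 0}"

definition D1 :: "(complex ^ 3 ^ 3) set \<Rightarrow> bool"
  where "D1 L \<longleftrightarrow> cdim L = 6"

definition D2 :: "(complex ^ 3 ^ 3) set \<Rightarrow> bool"
  where "D2 L \<longleftrightarrow> cdim L < 5"

definition D3 :: "(complex ^ 3 ^ 3) set \<Rightarrow> bool"
  where "D3 L \<longleftrightarrow> cdim L = 5 \<and> cdim (L \<inter> M3) > 2"

definition D4 :: "(complex ^ 3 ^ 3) set \<Rightarrow> bool"
  where "D4 L \<longleftrightarrow> cdim L = 5 \<and> cdim (L \<inter> M3) = 2"

definition lex_less :: "3 \<times> 3 \<Rightarrow> 3 \<times> 3 \<Rightarrow> bool"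
  where "lex_less p q \<longleftrightarrow>
    off (fst p) < off (fst q) \<or> fst p = fst q \<and> off (snd p) < off (snd q)"

definition canonical_basis ::
    "(complex ^ 3 ^ 3) set \<Rightarrow> complex ^ 3 ^ 3 \<Rightarrow> complex ^ 3 ^ 3 \<Rightarrow> bool"
  where "canonical_basis L0 L1 L2 \<longleftrightarrow>
    L1 \<noteq> L2 \<and> \<not> cdependent {L1, L2} \<and> cspan {L1, L2} = L0 \<and>
    (\<exists>i1 j1 i2 j2. j1 \<in> {1, 2} \<and> j2 \<in> {1, 2} \<and> lex_less (i1, j1) (i2, j2) \<and>
      L1 $ i1 $ j1 = 1 \<and> L1 $ i2 $ j2 = 0 \<and> L2 $ i1 $ j1 = 0 \<and> L2 $ i2 $ j2 = 1 \<and>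
      (\<forall>i. \<forall>j\<in>{1, 2}. lex_less (i, j) (i1, j1) \<longrightarrow> L1 $ i $ j = 0) \<and>
      (\<forall>i. \<forall>j\<in>{1, 2}. lex_less (i, j) (i2, j2) \<longrightarrow> L2 $ i $ j = 0))"

text \<open>The diagonal matrix \<open>\<Delta>\<close> is given by its diagonal \<open>b\<close>.\<close>

definition b_Delta2 :: "complex ^ 3 \<Rightarrow> complex"
  where "b_Delta2 b = 1 / b $ 3 - 1 / b $ 1"

definition b_Delta3 :: "complex ^ 3 \<Rightarrow> complex"
  where "b_Delta3 b = 1 / b $ 2 - 1 / b $ 1"

definition form_E7_0 :: "complex ^ 3 \<Rightarrow> complex ^ 3 ^ 3 \<Rightarrow> complex ^ 3 ^ 3 \<Rightarrow> bool"
  where "form_E7_0 b L1 L2 \<longleftrightarrow> (\<exists>x y. x * y \<noteq> 0 \<and>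
    L1 = vector [vector [1, 0, 0],
                 vector [x, 0, 0],
                 vector [y, 0, 0]] \<and>
    L2 = vector [vector [0, 1, 0],
                 vector [b_Delta3 b * x, x, 0],
                 vector [b_Delta2 b * y, y, 0]])"

end

theory Submission
  imports Defs "HOL-Computational_Algebra.Polynomial"
begin

text \<open>Let \<open>X = Q\<^sub>3\<^sub>1\<close>. Comparing the (3,1) entries of \<open>Q That = That Q\<close> and using that \<open>F\<close> has rank one, the
  matrix \<open>x\<close> of \<open>X\<close> satisfies \<open>x\<^sub>i\<^sub>,\<^sub>j\<^sub>+\<^sub>1 = \<mu>\<^sub>i x\<^sub>i\<^sub>,\<^sub>j + f\<^sub>i u\<^sub>j\<close>, where \<open>f\<close> spans the range of \<open>F\<close> and only
  \<open>u\<close> depends on \<open>Q\<close>. It suffices to find nonzero \<open>h\<close>, \<open>b\<close> such that every \<open>X h\<close> is orthogonal to \<open>b\<close>.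

  If \<open>f\<^sub>i = 0\<close> for some \<open>i\<close>, take \<open>b = e\<^sub>i\<close> and \<open>h = e\<^sub>1 - \<mu>\<^sub>i e\<^sub>0\<close>. Otherwise each cross-section lies in a space of
  dimension 5 that meets \<open>M3\<close> in the span of an \<open>(E7\<^sub>0)\<close> pair, so only (D2) remains. It yields a linear
  relation between the entries \<open>x\<^sub>i\<^sub>,\<^sub>r\<close> of three rows, \<open>u\<^sub>r\<close> and \<open>u\<^sub>r\<^sub>+\<^sub>1\<close>. Since \<open>L31\<close> is stable under right
  multiplication by the shift, the relation persists at every index; eliminating the rows gives a
  nonzero polynomial \<open>q\<close> in the index shift that annihilates \<open>u\<close>, and then \<open>(z - \<mu>\<^sub>r) q\<close> annihilates row \<open>r\<close>.\<close>

section \<open>Complex inner products and operators given by orthonormal series\<close>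

lemma cinner_zero_left[simp]: "cinner 0 y = 0"
  using cinner_add_left[of 0 0 y] by simp

lemma cinner_sum_left: "cinner (sum g A) y = (\<Sum>x\<in>A. cinner (g x) y)"
  by (induction A rule: infinite_finite_induct) (simp_all add: cinner_add_left)

lemma cinner_scaleC_right: "cinner x (c *\<^sub>C y) = cnj c * cinner x y"
  by (metis cinner_commute cinner_scaleC_left complex_cnj_mult)

lemma norm_scaleC: "norm (c *\<^sub>C x) = norm c * norm (x :: 'a :: complex_hilbert)"
proof -
  have "(norm (c *\<^sub>C x))\<^sup>2 = Re (c * cnj c * cinner x x)"
    by (simp add: power2_norm_eq_inner inner_eq_Re_cinner cinner_scaleC_left cinner_scaleC_right mult_ac)
  also have "\<dots> = (norm c * norm x)\<^sup>2"
    by (simp add: complex_norm_square[symmetric] power_mult_distrib power2_norm_eq_inner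
      inner_eq_Re_cinner Re_complex_of_real del: of_real_power flip: of_real_power)
  finally show ?thesis
    by (simp add: power2_eq_iff_nonneg)
qed

lemma bounded_linear_scaleC: "bounded_linear ((*\<^sub>C) c :: 'a \<Rightarrow> 'a :: complex_hilbert)"
proof (rule bounded_linear_intro)
  show "c *\<^sub>C r *\<^sub>R x = r *\<^sub>R c *\<^sub>C x" for r and x :: 'a
    by (simp add: scaleR_eq_scaleC scaleC_scaleC mult.commute)
  show "norm (c *\<^sub>C x) \<le> norm x * norm c" for x :: 'a
    by (simp add: norm_scaleC)
qed (simp add: scaleC_add_right)

lemma Im_cinner: "Im (cinner x y) = inner ((- \<i>) *\<^sub>C x) y"
  by (simp add: inner_eq_Re_cinner cinner_scaleC_left del: complex_vector.scale_minus_left)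

text \<open>Continuity is known for the real \<open>inner\<close>. The real part of
  \<open>cinner\<close> is a real inner product, and so is the imaginary part once the first
  argument is multiplied by \<open>- \<i>\<close>.\<close>

lemma bounded_linear_cinner_left: "bounded_linear (\<lambda>x. cinner x y)"
proof -
  have "cinner x y = of_real (inner x y) + of_real (inner ((- \<i>) *\<^sub>C x) y) * \<i>" for x
    by (simp only: complex_eq_iff Im_cinner[symmetric]) (simp add: inner_eq_Re_cinner)
  moreover have "bounded_linear (\<lambda>x. complex_of_real (inner x y) + of_real (inner ((- \<i>) *\<^sub>C x) y) * \<i>)"
    by (intro bounded_linear_add bounded_linear_compose[OF bounded_linear_of_real]
      bounded_linear_mult_const bounded_linear_inner_left_comp bounded_linear_scaleC
      bounded_linear_ident bounded_linear_inner_left)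
  ultimately show ?thesis
    by presburger
qed

lemma orthonormal_basisD: "orthonormal_basis e \<Longrightarrow> cinner (e i) (e j) = (if i = j then 1 else 0)"
  by (simp add: orthonormal_basis_def)

text \<open>For the projection \<open>p\<close> of \<open>h\<close> onto the first \<open>n\<close>
  basis vectors, \<open>inner h p\<close> and \<open>inner p p\<close> both equal the sum, so
  Cauchy-Schwarz gives \<open>norm p \<le> norm h\<close>.\<close>

lemma bessel:
  assumes "orthonormal_basis e"
  shows "(\<Sum>k<n. (norm (cinner h (e k)))\<^sup>2) \<le> (norm h)\<^sup>2"
proof -
  note e = orthonormal_basisD[OF assms]
  define p where "p = (\<Sum>k<n. cinner h (e k) *\<^sub>C e k)"
  have *: "cinner p (e k) = (if k < n then cinner h (e k) else 0)" for k
    by (simp add: p_def cinner_sum_left cinner_scaleC_left e if_distrib[of "(*) _"] cong: if_cong)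
  have eq: "cinner g p = (\<Sum>k<n. cnj (cinner h (e k)) * cinner g (e k))" for g
    by (subst cinner_commute) (simp add: p_def cinner_sum_left cinner_scaleC_left
      flip: cinner_commute[of g])
  have "inner h p = (\<Sum>k<n. (norm (cinner h (e k)))\<^sup>2)"
    unfolding inner_eq_Re_cinner eq Re_sum
    by (intro sum.cong refl) (simp add: cmod_power2 flip: power2_eq_square)
  moreover have "inner p p = inner h p"
    unfolding inner_eq_Re_cinner eq Re_sum by (intro sum.cong refl) (simp add: *)
  moreover have "inner p p \<le> (norm h)\<^sup>2"
  proof -
    have "norm p * norm p \<le> norm h * norm p"
      using norm_cauchy_schwarz[of h p] calculation by (simp flip: power2_norm_eq_inner add: power2_eq_square)
    then have "norm p \<le> norm h"
      by (cases "p = 0") auto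
    then show ?thesis
      by (simp flip: power2_norm_eq_inner)
  qed
  ultimately show ?thesis
    by simp
qed

text \<open>The value of a \<open>suminf\<close> is meaningful only once the series converges.
  Bessel's inequality and the bound on \<open>d\<close> make the squared norms of the terms
  summable; by orthogonality the partial sums are then Cauchy, and the continuous functional may be
  applied term by term.\<close>

lemma cinner_diagonal_op:
  assumes e: "orthonormal_basis e" and d: "Bseq d"
  shows "cinner (diagonal_op e d h) (e i) = d i * cinner h (e i)"
proof -
  define t where "t k = d k *\<^sub>C rank_one (e k) (e k) h" for k
  obtain K where K: "norm (d k) \<le> K" "K > 0" for k
    using d by (metis BseqE)
  have norm_e: "norm (e k) = 1" for k
    using orthonormal_basisD[OF e, of k k] by (simp add: norm_eq_sqrt_inner inner_eq_Re_cinner)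
  have t: "norm (t k) \<le> K * norm (cinner h (e k))" for k
    by (simp add: t_def rank_one_def norm_scaleC norm_e norm_mult K mult_right_mono)
  have "summable (\<lambda>k. (norm (cinner h (e k)))\<^sup>2)"
    using bessel[OF e] by (intro summableI_nonneg_bounded) auto
  then have "summable (\<lambda>k. K\<^sup>2 * (norm (cinner h (e k)))\<^sup>2)"
    by (rule summable_mult)
  moreover have "norm ((norm (t k))\<^sup>2) \<le> K\<^sup>2 * (norm (cinner h (e k)))\<^sup>2" for k
    using power_mono[OF t norm_ge_zero, of k 2] by (simp add: power_mult_distrib)
  ultimately have sq: "summable (\<lambda>k. (norm (t k))\<^sup>2)"
    by (rule summable_comparison_test')
  have "orthogonal (t i) (t j)" if "i \<noteq> j" for i j
    using that unfolding orthogonal_def inner_eq_Re_cinner t_def rank_one_def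
      cinner_scaleC_left cinner_scaleC_right orthonormal_basisD[OF e] by simp
  then have orth: "(norm (sum t A))\<^sup>2 = (\<Sum>k\<in>A. (norm (t k))\<^sup>2)" if "finite A" for A
    by (intro norm_sum_Pythagorean[OF that]) (simp add: pairwise_def)
  have "Cauchy (\<lambda>n. sum t {..<n})"
  proof (rule CauchyI')
    fix \<epsilon> :: real assume \<epsilon>: "\<epsilon> > 0"
    obtain N where N: "\<And>m n. m \<ge> N \<Longrightarrow> norm (\<Sum>k=m..<n. (norm (t k))\<^sup>2) < \<epsilon>\<^sup>2"
      using sq \<epsilon> unfolding summable_Cauchy by (metis zero_less_power)
    have "norm (sum t {..<m} - sum t {..<n}) < \<epsilon>" if "N \<le> m" "m < n" for m n
    proof -
      have "sum t {..<n} - sum t {..<m} = sum t {m..<n}"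
        using that by (simp add: sum_diff_nat_ivl[of 0 m n, symmetric] lessThan_atLeast0)
      moreover have "(norm (sum t {m..<n}))\<^sup>2 < \<epsilon>\<^sup>2"
        using N[OF that(1), of n] by (simp add: orth)
      ultimately show ?thesis
        using \<epsilon> by (metis norm_minus_commute less_imp_le power2_less_imp_less)
    qed
    then show "\<exists>N. \<forall>m\<ge>N. \<forall>n>m. dist (sum t {..<m}) (sum t {..<n}) < \<epsilon>"
      unfolding dist_norm by blast
  qed
  then have "summable t"
    unfolding summable_iff_convergent by (rule Cauchy_convergent)
  then have "cinner (suminf t) (e i) = (\<Sum>k. cinner (t k) (e i))"
    by (rule bounded_linear.suminf[OF bounded_linear_cinner_left])
  also have "\<dots> = (\<Sum>k\<in>{i}. cinner (t k) (e i))"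
    by (rule suminf_finite) (auto simp: t_def rank_one_def cinner_scaleC_left orthonormal_basisD[OF e])
  also have "\<dots> = d i * cinner h (e i)"
    by (simp add: t_def rank_one_def cinner_scaleC_left orthonormal_basisD[OF e])
  also have "suminf t = diagonal_op e d h"
    unfolding diagonal_op_def t_def[abs_def] ..
  finally show ?thesis .
qed

text \<open>At a basis vector the series has a single nonzero term, so its convergence is
  immediate.\<close>

lemma unilateral_shift_basis:
  assumes "orthonormal_basis e"
  shows "unilateral_shift e (e k) = e (Suc k)"
proof -
  have "(\<Sum>j. rank_one (e (Suc j)) (e j) (e k)) = (\<Sum>j\<in>{k}. rank_one (e (Suc j)) (e j) (e k))"
    by (rule suminf_finite) (auto simp: rank_one_def orthonormal_basisD[OF assms])
  then show ?thesis
    by (simp add: unilateral_shift_def rank_one_def orthonormal_basisD[OF assms] scaleC_one)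
qed

lemma off_simps [simp]: "off 1 = 0" "off 2 = 1" "off 3 = 2"
  by (simp_all add: off_def)

section \<open>Bounded operators, commutants and closures of orbits\<close>

lemma bounded_clinearI: "bounded_linear f \<Longrightarrow> (\<And>c x. f (c *\<^sub>C x) = c *\<^sub>C f x) \<Longrightarrow> bounded_clinear f"
  by (simp add: bounded_clinear_def)

lemma bounded_clinear_bounded_linear: "bounded_clinear f \<Longrightarrow> bounded_linear f"
  by (simp add: bounded_clinear_def)

lemma bounded_clinear_scaleC: "bounded_clinear f \<Longrightarrow> f (c *\<^sub>C x) = c *\<^sub>C f x"
  by (simp add: bounded_clinear_def)

lemma bounded_clinear_plus: "bounded_clinear f \<Longrightarrow> f (x + y) = f x + f y"
  by (simp add: bounded_clinear_def linear_simps)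

lemma bounded_clinear_minus: "bounded_clinear f \<Longrightarrow> f (x - y) = f x - f y"
  by (simp add: bounded_clinear_def linear_simps)

lemma bounded_clinear_0: "bounded_clinear f \<Longrightarrow> f 0 = 0"
  by (simp add: bounded_clinear_def linear_simps)

lemmas bounded_clinear_simps =
  bounded_clinear_scaleC bounded_clinear_plus bounded_clinear_minus bounded_clinear_0

lemma bounded_clinear_id: "bounded_clinear (\<lambda>x. x)"
  by (simp add: bounded_clinear_def)

lemma bounded_clinear_zero: "bounded_clinear (\<lambda>_. 0)"
  by (simp add: bounded_clinear_def)

lemma bounded_clinear_comp: "bounded_clinear f \<Longrightarrow> bounded_clinear g \<Longrightarrow> bounded_clinear (f \<circ> g)"
  by (simp add: bounded_clinear_def bounded_linear_compose o_def)

lemma bounded_clinear_sum: "bounded_clinear f \<Longrightarrow> bounded_clinear g \<Longrightarrow> bounded_clinear (\<lambda>x. f x + g x)"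
  by (simp add: bounded_clinear_def bounded_linear_add scaleC_add_right)

lemma bounded_clinear_scale: "bounded_clinear f \<Longrightarrow> bounded_clinear (\<lambda>x. c *\<^sub>C f x)"
  by (auto simp: bounded_clinear_def scaleC_scaleC mult.commute
    intro: bounded_linear_compose[OF bounded_linear_scaleC])

lemma bounded_clinear_block_op:
  assumes "bounded_clinear a" "bounded_clinear b" "bounded_clinear c" "bounded_clinear d"
  shows "bounded_clinear (block_op a b c d)"
proof (rule bounded_clinearI)
  note lin = assms[THEN bounded_clinear_bounded_linear]
  show "bounded_linear (block_op a b c d)"
    unfolding block_op_def split_beta
    by (intro bounded_linear_Pair bounded_linear_add lin[THEN bounded_linear_compose]
      bounded_linear_fst bounded_linear_snd)
qed (simp add: block_op_def split_beta scaleC_prod_def bounded_clinear_simps assms scaleC_add_right)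

lemma bounded_invertible_inv:
  assumes "bounded_invertible f"
  shows "bounded_clinear (inv f)" "inv f \<circ> f = id" "f \<circ> inv f = id"
proof -
  obtain g where g: "bounded_clinear g" "g \<circ> f = id" "f \<circ> g = id"
    using assms by (auto simp: bounded_invertible_def)
  then have "inv f = g"
    by (intro inv_unique_comp)
  with g show "bounded_clinear (inv f)" "inv f \<circ> f = id" "f \<circ> inv f = id"
    by simp_all
qed

lemma commutant_iff: "Q \<in> commutant T \<longleftrightarrow> bounded_clinear Q \<and> (\<forall>x. Q (T x) = T (Q x))"
  by (simp only: commutant_def mem_Collect_eq fun_eq_iff comp_apply)

lemma csubspace_closure:
  assumes M: "csubspace M"
  shows "csubspace (closure M)"
  unfolding complex_vector.subspace_def
proof (intro conjI ballI allI)
  show "0 \<in> closure M"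
    using M by (intro subsetD[OF closure_subset]) (simp add: complex_vector.subspace_def)
  fix x y assume "x \<in> closure M" "y \<in> closure M"
  then obtain s t where "\<And>n. s n \<in> M" "s \<longlonglongrightarrow> x" "\<And>n. t n \<in> M" "t \<longlonglongrightarrow> y"
    unfolding closure_sequential by blast
  with M show "x + y \<in> closure M"
    unfolding closure_sequential
    by (intro exI[of _ "\<lambda>n. s n + t n"]) (auto simp: complex_vector.subspace_def intro: tendsto_add)
next
  fix c x assume "x \<in> closure M"
  then obtain s where "\<And>n. s n \<in> M" "s \<longlonglongrightarrow> x"
    unfolding closure_sequential by blast
  with M show "c *\<^sub>C x \<in> closure M"
    unfolding closure_sequential
    by (intro exI[of _ "\<lambda>n. c *\<^sub>C s n"])
      (auto simp: complex_vector.subspace_def intro: bounded_linear.tendsto[OF bounded_linear_scaleC])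
qed

text \<open>The commutant is a unital algebra: sums and multiples make the orbit a subspace,
  products make it invariant, and the identity puts \<open>x\<close> into it.\<close>

lemma nontrivial_hyperinvariant_closure_orbit:
  assumes T: "bounded_clinear T" and x: "x \<noteq> 0" and not_dense: "closure (commutant_orbit T x) \<noteq> UNIV"
  shows "nontrivial_hyperinvariant T (closure (commutant_orbit T x))"
proof -
  have bounded: "bounded_clinear Q" and commute: "Q (T y) = T (Q y)" if "Q \<in> commutant T" for Q y
    using that by (auto simp: commutant_def fun_eq_iff)
  have "csubspace (commutant_orbit T x)"
    unfolding complex_vector.subspace_def
  proof (intro conjI ballI allI)
    have "(\<lambda>_. 0) \<in> commutant T"
      by (simp add: commutant_def bounded_clinear_zero fun_eq_iff bounded_clinear_0 T)
    then show "0 \<in> commutant_orbit T x"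
      by (force simp: commutant_orbit_def)
  next
    fix y z assume "y \<in> commutant_orbit T x" "z \<in> commutant_orbit T x"
    then obtain Q R where Q: "Q \<in> commutant T" "y = Q x" and R: "R \<in> commutant T" "z = R x"
      by (auto simp: commutant_orbit_def)
    have "(\<lambda>w. Q w + R w) \<in> commutant T"
      using Q R by (simp add: commutant_def bounded_clinear_sum fun_eq_iff bounded_clinear_plus T)
    then show "y + z \<in> commutant_orbit T x"
      using Q R by (force simp: commutant_orbit_def)
  next
    fix c y assume "y \<in> commutant_orbit T x"
    then obtain Q where Q: "Q \<in> commutant T" "y = Q x"
      by (auto simp: commutant_orbit_def)
    have "(\<lambda>w. c *\<^sub>C Q w) \<in> commutant T"
      using Q by (simp add: commutant_def bounded_clinear_scale fun_eq_iff bounded_clinear_scaleC T)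
    then show "c *\<^sub>C y \<in> commutant_orbit T x"
      using Q by (force simp: commutant_orbit_def)
  qed
  moreover have "Q ` closure (commutant_orbit T x) \<subseteq> closure (commutant_orbit T x)"
    if Q: "Q \<in> commutant T" for Q
  proof (rule image_closure_subset)
    show "continuous_on (closure (commutant_orbit T x)) Q"
      using bounded[OF Q] by (intro linear_continuous_on bounded_clinear_bounded_linear)
    have comp: "Q \<circ> R \<in> commutant T" if "R \<in> commutant T" for R
      using Q that by (simp add: commutant_def bounded_clinear_comp fun_eq_iff)
    have "Q ` commutant_orbit T x \<subseteq> commutant_orbit T x"
    proof
      fix y assume "y \<in> Q ` commutant_orbit T x"
      then obtain R where "R \<in> commutant T" "y = (Q \<circ> R) x"
        by (auto simp: commutant_orbit_def)
      then show "y \<in> commutant_orbit T x"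
        unfolding commutant_orbit_def using comp by blast
    qed
    then show "Q ` commutant_orbit T x \<subseteq> closure (commutant_orbit T x)"
      using closure_subset by blast
  qed simp
  moreover have "x \<in> closure (commutant_orbit T x)"
  proof -
    have "(\<lambda>w. w) \<in> commutant T"
      by (simp add: commutant_def bounded_clinear_id fun_eq_iff)
    then show ?thesis
      by (intro subsetD[OF closure_subset]) (force simp: commutant_orbit_def)
  qed
  ultimately show ?thesis
    using x not_dense
    by (auto simp: nontrivial_hyperinvariant_def hyperinvariant_def csubspace_closure)
qed

section \<open>Linear algebra of three consecutive columns\<close>

lemma exists_annihilating_functional:
  fixes L G :: "'a :: complex_hilbert set"
  assumes indep: "\<not> cdependent G" and L: "L \<subseteq> cspan G" and dim: "cdim L < card G"
  obtains \<phi> :: "'a \<Rightarrow> complex"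
  where "\<And>x y. \<phi> (x + y) = \<phi> x + \<phi> y" "\<And>c x. \<phi> (c *\<^sub>C x) = c * \<phi> x"
    "\<And>x. x \<in> L \<Longrightarrow> \<phi> x = 0" "\<exists>x\<in>G. \<phi> x \<noteq> 0"
proof -
  \<comment> \<open>An infinite \<open>G\<close> would have \<open>card G = 0\<close>, against
    \<open>dim\<close>.\<close>
  have fin: "finite G"
    using dim card.infinite by fastforce
  obtain B where B: "B \<subseteq> L" "\<not> cdependent B" "L \<subseteq> cspan B" "card B = cdim L"
    by (rule complex_vector.basis_exists)
  have "finite B"
    using complex_vector.independent_span_bound[OF fin B(2)] B(1) L by blast
  then have "\<not> G \<subseteq> cspan B"
    using complex_vector.independent_span_bound[OF _ indep, of B] B(4) dim by auto
  then obtain x where x: "x \<in> G" "x \<notin> cspan B"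
    by blast
  have indep': "\<not> cdependent (insert x B)"
    by (rule complex_vector.independent_insertI[OF x(2) B(2)])
  \<comment> \<open>\<open>\<phi>\<close> is the coordinate along \<open>x\<close> in a basis
    containing \<open>insert x B\<close>; it vanishes on \<open>cspan B\<close> and hence on
    \<open>L\<close>.\<close>
  define C where "C = complex_vector.extend_basis (insert x B)"
  define \<phi> where "\<phi> y = complex_vector.representation C y x" for y
  have C: "\<not> cdependent C" "cspan C = UNIV" "insert x B \<subseteq> C"
    using complex_vector.independent_extend_basis[OF indep'] complex_vector.span_extend_basis[OF indep']
      complex_vector.extend_basis_superset[OF indep'] by (simp_all add: C_def)
  have "x \<notin> B"
    using x complex_vector.span_base by blast
  have "\<phi> y = 0" if "y \<in> L" for y
  proof -
    have "\<phi> y = complex_vector.representation B y x"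
      unfolding \<phi>_def
      by (subst complex_vector.representation_extend[OF C(1), of y B]) (use that B C in auto)
    also have "\<dots> = 0"
      using complex_vector.representation_ne_zero \<open>x \<notin> B\<close> by blast
    finally show ?thesis .
  qed
  moreover have "\<phi> x = 1"
    using complex_vector.representation_basis[OF C(1), of x] C(3) by (simp add: \<phi>_def)
  then have "\<exists>x\<in>G. \<phi> x \<noteq> 0"
    using x(1) by (intro bexI[of _ x]) auto
  ultimately show thesis
    using C(1,2) by (intro that[of \<phi>])
      (simp_all add: \<phi>_def complex_vector.representation_add complex_vector.representation_scale)
qed

text \<open>The general 3 by 3 matrix obeying the recurrence: the first column \<open>a\<close> is
  free, and each later column is the previous one scaled by \<open>b\<close>, plus \<open>u\<close>
  or \<open>v\<close> times \<open>g\<close>. The five free parameters account for the dimension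
  5.\<close>

definition row_matrix :: "complex ^ 3 \<Rightarrow> complex ^ 3 \<Rightarrow> complex ^ 3 \<Rightarrow> complex \<Rightarrow> complex \<Rightarrow> complex ^ 3 ^ 3"
  where "row_matrix b g a u v = (\<chi> i j.
    if j = 1 then a $ i
    else if j = 2 then b $ i * a $ i + g $ i * u
    else b $ i * (b $ i * a $ i + g $ i * u) + g $ i * v)"

definition row_generators :: "complex ^ 3 \<Rightarrow> complex ^ 3 \<Rightarrow> (complex ^ 3 ^ 3) list"
  where "row_generators b g =
    [row_matrix b g (axis 1 1) 0 0, row_matrix b g (axis 2 1) 0 0, row_matrix b g (axis 3 1) 0 0,
     row_matrix b g 0 1 0, row_matrix b g 0 0 1]"

lemma row_matrix_decompose:
  "row_matrix b g a u v =
    a $ 1 *\<^sub>C row_matrix b g (axis 1 1) 0 0 + a $ 2 *\<^sub>C row_matrix b g (axis 2 1) 0 0 +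
    a $ 3 *\<^sub>C row_matrix b g (axis 3 1) 0 0 + u *\<^sub>C row_matrix b g 0 1 0 + v *\<^sub>C row_matrix b g 0 0 1"
  by (simp add: row_matrix_def vec_eq_iff forall_3 scaleC_vec_def scaleC_complex_def axis_def algebra_simps)

lemma row_matrix_in_span: "row_matrix b g a u v \<in> cspan (set (row_generators b g))"
  unfolding row_matrix_decompose[of b g a u v]
  by (intro complex_vector.span_add complex_vector.span_scale complex_vector.span_base)
    (simp_all add: row_generators_def)

lemma distinct_row_generators:
  assumes "g $ 1 \<noteq> 0"
  shows "distinct (row_generators b g)"
  using assms by (auto simp: row_generators_def row_matrix_def vec_eq_iff forall_3 axis_def)

text \<open>A linear combination of the generators is the \<open>row_matrix\<close> whose parameters
  are the weights. If it vanishes, its columns in turn give \<open>a = 0\<close>,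
  \<open>u = 0\<close> and \<open>v = 0\<close>; the last two are read off the first row, where
  \<open>g $ 1 \<noteq> 0\<close>.\<close>

lemma independent_row_generators:
  assumes "g $ 1 \<noteq> 0"
  shows "\<not> cdependent (set (row_generators b g))"
proof
  assume "cdependent (set (row_generators b g))"
  then obtain w where w: "\<exists>M\<in>set (row_generators b g). w M \<noteq> 0"
      "(\<Sum>M\<in>set (row_generators b g). w M *\<^sub>C M) = 0"
    unfolding complex_vector.dependent_finite[OF finite_set] by blast
  have "row_matrix b g (vector [w (row_matrix b g (axis 1 1) 0 0), w (row_matrix b g (axis 2 1) 0 0),
    w (row_matrix b g (axis 3 1) 0 0)]) (w (row_matrix b g 0 1 0)) (w (row_matrix b g 0 0 1)) = 0"
    using w(2) unfolding sum.distinct_set_conv_list[OF distinct_row_generators[OF assms]]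
    by (subst row_matrix_decompose) (simp add: row_generators_def add.assoc)
  with w(1) assms show False
    by (auto simp: row_generators_def row_matrix_def vec_eq_iff forall_3)
qed

section \<open>Matrices with zero third column and the form (E7_0)\<close>

definition E7_first :: "complex \<Rightarrow> complex \<Rightarrow> complex ^ 3 ^ 3"
  where "E7_first x y = vector [vector [1, 0, 0], vector [x, 0, 0], vector [y, 0, 0]]"

definition E7_second :: "complex ^ 3 \<Rightarrow> complex \<Rightarrow> complex \<Rightarrow> complex ^ 3 ^ 3"
  where "E7_second b x y =
    vector [vector [0, 1, 0], vector [b_Delta3 b * x, x, 0], vector [b_Delta2 b * y, y, 0]]"

text \<open>A zero third column lets the recurrence be solved backwards, as
  \<open>b $ i \<noteq> 0\<close>: the second column is \<open>- g $ i * v / b $ i\<close>, and the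
  first follows from it. So \<open>M\<close> depends on \<open>u\<close> and \<open>v\<close> alone;
  taking its first two entries in row 1 as parameters instead produces \<open>x\<close>,
  \<open>y\<close> and the differences of reciprocals \<open>b_Delta2\<close>,
  \<open>b_Delta3\<close>.\<close>

lemma row_matrix_M3:
  assumes b: "\<And>i. b $ i \<noteq> 0" and g: "g $ 1 \<noteq> 0"
    and M: "M = row_matrix b g a u v" "M \<in> M3"
  defines "x \<equiv> g $ 2 * b $ 1 / (g $ 1 * b $ 2)" and "y \<equiv> g $ 3 * b $ 1 / (g $ 1 * b $ 3)"
  shows "M = M $ 1 $ 1 *\<^sub>C E7_first x y + M $ 1 $ 2 *\<^sub>C E7_second b x y"
proof -
  have "b $ i * (b $ i * a $ i + g $ i * u) + g $ i * v = 0" for i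
    using M by (auto simp: M3_def row_matrix_def)
  then have c2: "b $ i * a $ i + g $ i * u = - (g $ i * v / b $ i)" for i
    using b[of i] by (simp add: field_simps eq_neg_iff_add_eq_0)
  have c1: "a $ i = - (g $ i * u / b $ i) - g $ i * v / (b $ i)\<^sup>2" for i
    using c2[of i] b[of i] by (simp add: field_simps power2_eq_square eq_neg_iff_add_eq_0)
  have M': "M = (\<chi> i j. if j = 1 then - (g $ i * u / b $ i) - g $ i * v / (b $ i)\<^sup>2
    else if j = 2 then - (g $ i * v / b $ i) else 0)"
    using M c2 c1[symmetric] by (simp add: vec_eq_iff forall_3 row_matrix_def M3_def)
  show ?thesis
    unfolding M' using b g
    by (simp add: vec_eq_iff forall_3 scaleC_vec_def scaleC_complex_def E7_first_def E7_second_def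
      b_Delta2_def b_Delta3_def x_def y_def field_simps power2_eq_square)
qed

text \<open>Members of \<open>L0\<close> are determined by their entries (1,1) and (1,2). As
  \<open>L2\<close> is nonzero, one of these entries of \<open>L2\<close> is nonzero, so its pivot
  cannot come after both positions. Since the pivot of \<open>L1\<close> comes earlier still, the
  pivots are exactly (1,1) and (1,2).\<close>

lemma canonical_basis_E7:
  assumes basis: "canonical_basis L0 L1 L2"
    and L0: "\<And>M. M \<in> L0 \<Longrightarrow> M = M $ 1 $ 1 *\<^sub>C E7_first x y + M $ 1 $ 2 *\<^sub>C E7_second b x y"
  shows "L1 = E7_first x y" "L2 = E7_second b x y"
proof -
  have "{L1, L2} \<subseteq> L0"
    using basis complex_vector.span_superset[of "{L1, L2}"] by (simp add: canonical_basis_def)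
  then have L1: "L1 = L1 $ 1 $ 1 *\<^sub>C E7_first x y + L1 $ 1 $ 2 *\<^sub>C E7_second b x y"
    and L2: "L2 = L2 $ 1 $ 1 *\<^sub>C E7_first x y + L2 $ 1 $ 2 *\<^sub>C E7_second b x y"
    using L0 by auto
  have top: "L $ 1 $ 1 \<noteq> 0 \<or> L $ 1 $ 2 \<noteq> 0"
    if "L = L $ 1 $ 1 *\<^sub>C E7_first x y + L $ 1 $ 2 *\<^sub>C E7_second b x y" "L $ i $ j = 1" for L i j
    using that by force
  obtain i1 j1 i2 j2 where p: "j1 \<in> {1, 2}" "j2 \<in> {1, 2}" "lex_less (i1, j1) (i2, j2)"
      "L1 $ i1 $ j1 = 1" "L1 $ i2 $ j2 = 0" "L2 $ i1 $ j1 = 0" "L2 $ i2 $ j2 = 1"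
      "\<forall>i. \<forall>j\<in>{1, 2}. lex_less (i, j) (i1, j1) \<longrightarrow> L1 $ i $ j = 0"
      "\<forall>i. \<forall>j\<in>{1, 2}. lex_less (i, j) (i2, j2) \<longrightarrow> L2 $ i $ j = 0"
    using basis unfolding canonical_basis_def by blast
  have "\<not> (lex_less (1, 1) (i2, j2) \<and> lex_less (1, 2) (i2, j2))"
    using p(9) top[OF L2 p(7)] by auto
  with p(1-3) have "i1 = 1 \<and> j1 = 1 \<and> i2 = 1 \<and> j2 = 2"
    using exhaust_3[of i1] exhaust_3[of i2] by (auto simp: lex_less_def)
  with p L1 L2 show "L1 = E7_first x y" "L2 = E7_second b x y"
    by (simp_all add: scaleC_one)
qed

section \<open>Families of operators whose matrix rows obey the recurrence\<close>

locale shift_invariant_rows =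
  fixes e :: "nat \<Rightarrow> 'h :: complex_hilbert" and S :: "'h \<Rightarrow> 'h" and \<X> :: "('h \<Rightarrow> 'h) set"
    and \<mu> f :: "nat \<Rightarrow> complex"
  assumes basis: "orthonormal_basis e"
    and S_add: "S (x + y) = S x + S y" and S_scale: "S (c *\<^sub>C x) = c *\<^sub>C S x"
    and S_basis: "S (e k) = e (Suc k)"
    and X_add: "X \<in> \<X> \<Longrightarrow> X (x + y) = X x + X y" and X_scale: "X \<in> \<X> \<Longrightarrow> X (c *\<^sub>C x) = c *\<^sub>C X x"
    and X_shift: "X \<in> \<X> \<Longrightarrow> X \<circ> S \<in> \<X>"
    and rows: "X \<in> \<X> \<Longrightarrow> \<exists>u. \<forall>i. cinner (X (S y)) (e i) = \<mu> i * cinner (X y) (e i) + f i * u"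
    and \<mu>_inj: "inj \<mu>" and \<mu>_nonzero: "\<mu> k \<noteq> 0"
begin

lemma e_inner: "cinner (e i) (e j) = (if i = j then 1 else 0)"
  by (rule orthonormal_basisD[OF basis])

lemma e_nonzero: "e i \<noteq> 0"
  using e_inner[of i i] by auto

definition entry :: "nat \<Rightarrow> ('h \<Rightarrow> 'h) \<Rightarrow> 'h \<Rightarrow> complex"
  where "entry i X y = cinner (X y) (e i)"

lemma entry_add: "X \<in> \<X> \<Longrightarrow> entry i X (x + y) = entry i X x + entry i X y"
  by (simp add: entry_def X_add cinner_add_left)

lemma entry_scale: "X \<in> \<X> \<Longrightarrow> entry i X (c *\<^sub>C x) = c * entry i X x"
  by (simp add: entry_def X_scale cinner_scaleC_left)

text \<open>Row \<open>i\<close> then has no rank-one term: composing it with \<open>S\<close> only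
  multiplies it by \<open>\<mu> i\<close>, so it kills the range of
  \<open>S - \<mu> i\<close>.\<close>

lemma annihilated_if_zero_row:
  assumes "f i = 0"
  shows "\<exists>h b. h \<noteq> 0 \<and> b \<noteq> 0 \<and> (\<forall>X\<in>\<X>. cinner (X h) b = 0)"
proof (intro exI conjI ballI)
  define h where "h = e 1 + (- \<mu> i) *\<^sub>C e 0"
  have "cinner h (e 1) = 1"
    by (simp add: h_def cinner_add_left cinner_scaleC_left e_inner del: complex_vector.scale_minus_left)
  then show "h \<noteq> 0"
    by auto
  fix X assume X: "X \<in> \<X>"
  then have "entry i X (S (e 0)) = \<mu> i * entry i X (e 0)"
    using rows[OF X, of "e 0"] assms by (auto simp: entry_def)
  then have "entry i X h = 0"
    unfolding h_def entry_add[OF X] entry_scale[OF X] by (simp add: S_basis)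
  then show "cinner (X h) (e i) = 0"
    by (simp add: entry_def)
qed (rule e_nonzero)

text \<open>The coefficient \<open>u\<close> of the header, read off row \<open>r\<close>; it needs \<open>f r \<noteq> 0\<close>.\<close>

definition defect :: "nat \<Rightarrow> ('h \<Rightarrow> 'h) \<Rightarrow> 'h \<Rightarrow> complex"
  where "defect r X y = (entry r X (S y) - \<mu> r * entry r X y) / f r"

lemma defect_add: "X \<in> \<X> \<Longrightarrow> defect r X (x + y) = defect r X x + defect r X y"
  by (simp add: defect_def S_add entry_add algebra_simps add_divide_distrib diff_divide_distrib)

lemma defect_scale: "X \<in> \<X> \<Longrightarrow> defect r X (c *\<^sub>C x) = c * defect r X x"
  by (simp add: defect_def S_scale entry_scale algebra_simps)

text \<open>The \<open>u\<close> in \<open>rows\<close> may depend on \<open>X\<close> and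
  \<open>y\<close> but not on the row, so solving for it in row \<open>r\<close> determines it in
  every row.\<close>

lemma entry_shift:
  assumes "X \<in> \<X>" "f r \<noteq> 0"
  shows "entry i X (S y) = \<mu> i * entry i X y + f i * defect r X y"
proof -
  obtain u where u: "\<And>i. entry i X (S y) = \<mu> i * entry i X y + f i * u"
    using rows[OF assms(1), of y] by (auto simp: entry_def)
  have "defect r X y = u"
    using assms(2) u[of r] by (simp add: defect_def)
  then show ?thesis
    using u by simp
qed

text \<open>Inner products with the three basis vectors of the window do not see
  \<open>proj3\<close>. The second and third columns come from the first by one and two uses of
  \<open>entry_shift\<close>.\<close>

lemma compression_matrix_eq:
  assumes X: "X \<in> \<X>" and f: "f r \<noteq> 0"
  shows "compression_matrix e r X = row_matrix (\<chi> i. \<mu> (r + off i)) (\<chi> i. f (r + off i))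
    (\<chi> i. entry (r + off i) X (e r)) (defect r X (e r)) (defect r X (e (Suc r)))"
proof -
  have proj: "cinner (proj3 e r h) (e (r + off i)) = cinner h (e (r + off i))" for h i
  proof -
    have "(\<Sum>k = r..r + 2. cinner h (e k) * cinner (e k) (e (r + off i))) =
      (\<Sum>k = r..r + 2. if k = r + off i then cinner h (e k) else 0)"
      by (intro sum.cong refl) (auto simp: e_inner)
    also have "\<dots> = cinner h (e (r + off i))"
      by (subst sum.delta) (auto simp: off_def)
    finally show ?thesis
      unfolding proj3_def rank_one_def cinner_sum_left cinner_scaleC_left .
  qed
  have "compression_matrix e r X $ i $ j = entry (r + off i) X (e (r + off j))" for i j
    by (simp add: compression_matrix_def proj entry_def)
  moreover have "e (Suc r) = S (e r)" "e (Suc (Suc r)) = S (S (e r))"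
    by (simp_all add: S_basis)
  ultimately show ?thesis
    by (simp add: row_matrix_def vec_eq_iff forall_3 entry_shift[OF X f] algebra_simps)
qed

text \<open>The vector \<open>p(S) (e r)\<close>.\<close>

definition shift_poly :: "nat \<Rightarrow> complex poly \<Rightarrow> 'h"
  where "shift_poly r p = (\<Sum>k\<le>degree p. coeff p k *\<^sub>C e (r + k))"

lemma S_sum: "S (sum g A) = (\<Sum>x\<in>A. S (g x))"
proof (induction A rule: infinite_finite_induct)
  case empty
  show ?case
    using S_scale[of 0 0] by simp
qed (use S_scale[of 0 0] in \<open>auto simp: S_add\<close>)

lemma shift_poly_0 [simp]: "shift_poly r 0 = 0"
  by (simp add: shift_poly_def)

text \<open>Horner's recursion: multiplication by the indeterminate becomes \<open>S\<close>. It
  drives the inductions over polynomials below.\<close>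

lemma shift_poly_pCons: "shift_poly r (pCons a p) = a *\<^sub>C e r + S (shift_poly r p)"
proof (cases "p = 0")
  case True
  then show ?thesis
    using S_scale[of 0 0] by (cases "a = 0") (auto simp: shift_poly_def)
next
  case False
  then show ?thesis
    by (simp add: shift_poly_def sum.atMost_Suc_shift S_sum S_scale S_basis del: sum.atMost_Suc)
qed

lemma shift_poly_add: "shift_poly r (p + q) = shift_poly r p + shift_poly r q"
  by (induction p q rule: poly_induct2)
    (simp_all add: shift_poly_pCons S_add scaleC_add_left)

lemma shift_poly_smult: "shift_poly r (smult c p) = c *\<^sub>C shift_poly r p"
  by (induction p) (simp_all add: shift_poly_pCons S_scale scaleC_add_right scaleC_scaleC)

lemma shift_poly_X: "shift_poly r (pCons 0 p) = S (shift_poly r p)"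
  by (simp add: shift_poly_pCons)

text \<open>The leading coefficient is the only one that contributes to the coordinate at
  \<open>e (r + degree p)\<close>.\<close>

lemma shift_poly_nonzero:
  assumes "p \<noteq> 0"
  shows "shift_poly r p \<noteq> 0"
proof -
  have "cinner (shift_poly r p) (e (r + degree p)) = lead_coeff p"
    by (simp add: shift_poly_def cinner_sum_left cinner_scaleC_left e_inner
      if_distrib[of "(*) _"] cong: if_cong)
  with assms show ?thesis
    by auto
qed

text \<open>The relation spreads from \<open>e r\<close> to all vectors
  \<open>shift_poly r p\<close>. At \<open>p = m0 * m1 * m2\<close> every row entry turns into a
  multiple of a defect, so the relation says that the defect vanishes at \<open>q\<close>; one more
  factor \<open>m0\<close> turns this into a statement about row \<open>r\<close>. The pair is
  therefore \<open>shift_poly r (m0 * q)\<close> and \<open>e r\<close>.\<close>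

lemma annihilated_if_relation:
  assumes f: "f r \<noteq> 0" "f (r + 1) \<noteq> 0" "f (r + 2) \<noteq> 0"
    and nontrivial: "\<alpha>0 \<noteq> 0 \<or> \<alpha>1 \<noteq> 0 \<or> \<alpha>2 \<noteq> 0 \<or> \<beta> \<noteq> 0 \<or> \<gamma> \<noteq> 0"
    and relation: "\<And>X. X \<in> \<X> \<Longrightarrow> \<alpha>0 * entry r X (e r) + \<alpha>1 * entry (r + 1) X (e r) +
      \<alpha>2 * entry (r + 2) X (e r) + \<beta> * defect r X (e r) + \<gamma> * defect r X (S (e r)) = 0"
  shows "\<exists>h b. h \<noteq> 0 \<and> b \<noteq> 0 \<and> (\<forall>X\<in>\<X>. cinner (X h) b = 0)"
proof -
  define R where "R X y = \<alpha>0 * entry r X y + \<alpha>1 * entry (r + 1) X y +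
      \<alpha>2 * entry (r + 2) X y + \<beta> * defect r X y + \<gamma> * defect r X (S y)" for X y
  have R_add: "R X (x + y) = R X x + R X y" and R_scale: "R X (c *\<^sub>C x) = c * R X x"
    if "X \<in> \<X>" for X x y c
    using that by (simp_all add: R_def entry_add entry_scale defect_add defect_scale S_add S_scale algebra_simps)
  \<comment> \<open>A shift of the argument is absorbed into the operator, which stays in the
    family; hence the induction below is over arbitrary \<open>X\<close>.\<close>
  have R_shift: "R X (S y) = R (X \<circ> S) y" for X y
    by (simp add: R_def entry_def defect_def)
  have R_poly: "R X (shift_poly r p) = 0" if "X \<in> \<X>" for X p
    using that
  proof (induction p arbitrary: X)
    case 0
    then show ?case
      using R_scale[of X 0 0] by simp
  next
    case (pCons a p)
    have "R X (e r) = 0"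
      using relation[OF pCons.prems] by (simp add: R_def)
    moreover have "R X (S (shift_poly r p)) = 0"
      unfolding R_shift by (intro pCons.IH X_shift pCons.prems)
    ultimately show ?case
      by (simp add: shift_poly_pCons R_add[OF pCons.prems] R_scale[OF pCons.prems])
  qed
  define m0 where "m0 = [:- \<mu> r, 1:]"
  define m1 where "m1 = [:- \<mu> (r + 1), 1:]"
  define m2 where "m2 = [:- \<mu> (r + 2), 1:]"
  define q where "q = smult (\<alpha>0 * f r) (m1 * m2) + smult (\<alpha>1 * f (r + 1)) (m0 * m2) +
    smult (\<alpha>2 * f (r + 2)) (m0 * m1) + [:\<beta>, \<gamma>:] * (m0 * m1 * m2)"
  \<comment> \<open>The factor with root \<open>\<mu> i\<close> cancels the diagonal term of row
    \<open>i\<close> and leaves only the rank-one term.\<close>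
  have linear_factor: "entry i X (shift_poly r ([:- \<mu> i, 1:] * p)) = f i * defect r X (shift_poly r p)"
    if X: "X \<in> \<X>" for i X p
  proof -
    have "shift_poly r ([:- \<mu> i, 1:] * p) = (- \<mu> i) *\<^sub>C shift_poly r p + S (shift_poly r p)"
      by (simp add: shift_poly_add shift_poly_smult shift_poly_X
        del: complex_vector.scale_minus_left smult_minus_left)
    then show ?thesis
      by (simp add: entry_add[OF X] entry_scale[OF X] entry_shift[OF X f(1)]
        del: complex_vector.scale_minus_left)
  qed
  have "defect r X (shift_poly r q) = 0" if X: "X \<in> \<X>" for X
  proof -
    define p where "p = m0 * m1 * m2"
    have *: "entry r X (shift_poly r p) = f r * defect r X (shift_poly r (m1 * m2))"
      "entry (r + 1) X (shift_poly r p) = f (r + 1) * defect r X (shift_poly r (m0 * m2))"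
      "entry (r + 2) X (shift_poly r p) = f (r + 2) * defect r X (shift_poly r (m0 * m1))"
      using linear_factor[OF X, of r "m1 * m2"] linear_factor[OF X, of "r + 1" "m0 * m2"]
        linear_factor[OF X, of "r + 2" "m0 * m1"]
      unfolding m0_def[symmetric] m1_def[symmetric] m2_def[symmetric]
      by (simp_all only: p_def mult_ac)
    \<comment> \<open>The linear factor in \<open>\<beta>\<close>, \<open>\<gamma>\<close> is split
      so that \<open>pCons 0\<close> matches the \<open>S\<close> in the last term of
      \<open>R\<close>.\<close>
    have "q = smult (\<alpha>0 * f r) (m1 * m2) + smult (\<alpha>1 * f (r + 1)) (m0 * m2) +
      smult (\<alpha>2 * f (r + 2)) (m0 * m1) + (smult \<beta> p + pCons 0 (smult \<gamma> p))"
      by (simp add: q_def p_def)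
    then have "defect r X (shift_poly r q) = R X (shift_poly r p)"
      by (simp only: R_def * shift_poly_add shift_poly_smult shift_poly_X S_scale
        defect_add[OF X] defect_scale[OF X] mult.assoc add.assoc)
    then show ?thesis
      using R_poly[OF X] by simp
  qed
  then have "cinner (X (shift_poly r (m0 * q))) (e r) = 0" if "X \<in> \<X>" for X
    using linear_factor[OF that, of r q] that by (simp add: entry_def m0_def)
  moreover have "m0 * q \<noteq> 0"
  proof
    assume "m0 * q = 0"
    have m_nonzero: "m0 \<noteq> 0" "m1 \<noteq> 0" "m2 \<noteq> 0"
      by (simp_all add: m0_def m1_def m2_def)
    have poly_m: "poly m0 z = z - \<mu> r" "poly m1 z = z - \<mu> (r + 1)" "poly m2 z = z - \<mu> (r + 2)" for z
      by (simp_all add: m0_def m1_def m2_def)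
    have q: "q = 0"
      using \<open>m0 * q = 0\<close> m_nonzero(1) by (simp only: mult_eq_0_iff simp_thms)
    have distinct: "\<mu> r \<noteq> \<mu> (r + 1)" "\<mu> r \<noteq> \<mu> (r + 2)" "\<mu> (r + 1) \<noteq> \<mu> (r + 2)"
      using \<mu>_inj by (simp_all add: inj_eq)
    \<comment> \<open>At the root of one of \<open>m0\<close>, \<open>m1\<close>, \<open>m2\<close>,
      the only summand of \<open>q\<close> that survives is the one lacking that factor, as in
      Lagrange interpolation.\<close>
    have "\<alpha>0 * f r * ((\<mu> r - \<mu> (r + 1)) * (\<mu> r - \<mu> (r + 2))) = poly q (\<mu> r)"
      "\<alpha>1 * f (r + 1) * ((\<mu> (r + 1) - \<mu> r) * (\<mu> (r + 1) - \<mu> (r + 2))) = poly q (\<mu> (r + 1))"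
      "\<alpha>2 * f (r + 2) * ((\<mu> (r + 2) - \<mu> r) * (\<mu> (r + 2) - \<mu> (r + 1))) = poly q (\<mu> (r + 2))"
      unfolding q_def poly_add poly_mult poly_smult poly_m by simp_all
    then have \<alpha>: "\<alpha>0 = 0" "\<alpha>1 = 0" "\<alpha>2 = 0"
      unfolding q poly_0 mult_eq_0_iff using f distinct by auto
    with q have "[:\<beta>, \<gamma>:] * (m0 * m1 * m2) = 0"
      unfolding q_def by (simp only: mult_zero_left smult_0_left add_0_left)
    then have "\<beta> = 0 \<and> \<gamma> = 0"
      using m_nonzero unfolding mult_eq_0_iff by simp
    with nontrivial \<alpha> show False
      by simp
  qed
  ultimately show ?thesis
    using e_nonzero shift_poly_nonzero by blast
qed

lemma compression_in_span:
  "f r \<noteq> 0 \<Longrightarrow> compression_matrix e r ` \<X> \<subseteq>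
    cspan (set (row_generators (\<chi> i. \<mu> (r + off i)) (\<chi> i. f (r + off i))))"
  by (auto simp: compression_matrix_eq row_matrix_in_span)

text \<open>The five generators are independent, so a cross-section of dimension below 5 is killed
  by a functional that is nonzero on some generator. Its values on the generators are the
  coefficients of the relation.\<close>

lemma annihilated_if_D2:
  assumes f: "f r \<noteq> 0" "f (r + 1) \<noteq> 0" "f (r + 2) \<noteq> 0" and D2: "D2 (compression_matrix e r ` \<X>)"
  shows "\<exists>h b. h \<noteq> 0 \<and> b \<noteq> 0 \<and> (\<forall>X\<in>\<X>. cinner (X h) b = 0)"
proof -
  define b :: "complex ^ 3" where "b = (\<chi> i. \<mu> (r + off i))"
  define g :: "complex ^ 3" where "g = (\<chi> i. f (r + off i))"
  have g: "g $ 1 \<noteq> 0"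
    using f by (simp add: g_def)
  have "cdim (compression_matrix e r ` \<X>) < card (set (row_generators b g))"
    using D2 distinct_card[OF distinct_row_generators[OF g]] by (simp add: D2_def row_generators_def)
  then obtain \<phi> :: "complex ^ 3 ^ 3 \<Rightarrow> complex" where
      \<phi>: "\<And>x y. \<phi> (x + y) = \<phi> x + \<phi> y" "\<And>c x. \<phi> (c *\<^sub>C x) = c * \<phi> x"
      "\<And>x. x \<in> compression_matrix e r ` \<X> \<Longrightarrow> \<phi> x = 0" "\<exists>x\<in>set (row_generators b g). \<phi> x \<noteq> 0"
    by (rule exists_annihilating_functional[OF independent_row_generators[OF g]
      compression_in_span[OF f(1), folded b_def g_def]]) blast
  show ?thesis
  proof (rule annihilated_if_relation[OF f])
    show "\<phi> (row_matrix b g (axis 1 1) 0 0) \<noteq> 0 \<or> \<phi> (row_matrix b g (axis 2 1) 0 0) \<noteq> 0 \<or>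
      \<phi> (row_matrix b g (axis 3 1) 0 0) \<noteq> 0 \<or> \<phi> (row_matrix b g 0 1 0) \<noteq> 0 \<or> \<phi> (row_matrix b g 0 0 1) \<noteq> 0"
      using \<phi>(4) by (simp add: row_generators_def)
    fix X assume X: "X \<in> \<X>"
    then have "\<phi> (row_matrix b g (\<chi> i. entry (r + off i) X (e r)) (defect r X (e r)) (defect r X (S (e r)))) = 0"
      using \<phi>(3)[OF imageI[OF X]]
      by (simp only: compression_matrix_eq[OF X f(1), folded b_def g_def] S_basis)
    then show "\<phi> (row_matrix b g (axis 1 1) 0 0) * entry r X (e r) +
        \<phi> (row_matrix b g (axis 2 1) 0 0) * entry (r + 1) X (e r) +
        \<phi> (row_matrix b g (axis 3 1) 0 0) * entry (r + 2) X (e r) +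
        \<phi> (row_matrix b g 0 1 0) * defect r X (e r) +
        \<phi> (row_matrix b g 0 0 1) * defect r X (S (e r)) = 0"
      unfolding row_matrix_decompose[of b g "\<chi> i. entry (r + off i) X (e r)"] \<phi>(1,2)
      by (simp add: mult.commute)
  qed
qed

text \<open>Once all \<open>f i\<close> are nonzero, the five generators exclude \<open>D1\<close>,
  the two spanning matrices of the intersection with \<open>M3\<close> exclude \<open>D3\<close>,
  and every canonical basis has the form (E7_0). This leaves \<open>D2\<close>.\<close>

lemma common_annihilated_pair:
  assumes cases: "(\<exists>r. D1 (compression_matrix e r ` \<X>) \<or> D2 (compression_matrix e r ` \<X>) \<or>
      D3 (compression_matrix e r ` \<X>)) \<or>
    (\<exists>r L1 L2. canonical_basis (compression_matrix e r ` \<X> \<inter> M3) L1 L2 \<and>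
      \<not> form_E7_0 (vector [\<mu> r, \<mu> (r + 1), \<mu> (r + 2)]) L1 L2)"
  shows "\<exists>h b. h \<noteq> 0 \<and> b \<noteq> 0 \<and> (\<forall>X\<in>\<X>. cinner (X h) b = 0)"
proof (cases "\<exists>i. f i = 0")
  case True
  then show ?thesis
    using annihilated_if_zero_row by blast
next
  case False
  then have f: "f i \<noteq> 0" for i
    by blast
  define L where "L r = compression_matrix e r ` \<X>" for r
  define b :: "nat \<Rightarrow> complex ^ 3" where "b r = (\<chi> i. \<mu> (r + off i))" for r
  define g :: "nat \<Rightarrow> complex ^ 3" where "g r = (\<chi> i. f (r + off i))" for r
  have b: "b r $ i \<noteq> 0" and g: "g r $ i \<noteq> 0" for r i
    using \<mu>_nonzero f by (simp_all add: b_def g_def)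
  \<comment> \<open>The witnesses are built from \<open>b r\<close> and \<open>g r\<close> alone, so
    a single pair serves all \<open>M\<close>.\<close>
  have E7: "\<exists>x y. x * y \<noteq> 0 \<and>
    (\<forall>M\<in>L r \<inter> M3. M = M $ 1 $ 1 *\<^sub>C E7_first x y + M $ 1 $ 2 *\<^sub>C E7_second (b r) x y)" for r
  proof (intro exI conjI ballI)
    fix M assume "M \<in> L r \<inter> M3"
    then obtain X where X: "X \<in> \<X>" "M = compression_matrix e r X" "M \<in> M3"
      by (auto simp: L_def)
    show "M = M $ 1 $ 1 *\<^sub>C E7_first (g r $ 2 * b r $ 1 / (g r $ 1 * b r $ 2)) (g r $ 3 * b r $ 1 / (g r $ 1 * b r $ 3)) +
      M $ 1 $ 2 *\<^sub>C E7_second (b r) (g r $ 2 * b r $ 1 / (g r $ 1 * b r $ 2)) (g r $ 3 * b r $ 1 / (g r $ 1 * b r $ 3))"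
      by (rule row_matrix_M3[OF b g X(2)[unfolded compression_matrix_eq[OF X(1) f], folded b_def g_def] X(3)])
  qed (use b g in simp)
  have "\<not> D1 (L r)" for r
  proof -
    have "cdim (L r) \<le> card (set (row_generators (b r) (g r)))"
      unfolding L_def b_def g_def by (intro complex_vector.dim_le_card compression_in_span f) simp
    also have "\<dots> \<le> 5"
      using card_length[of "row_generators (b r) (g r)"] by (simp add: row_generators_def)
    finally show ?thesis
      by (simp add: D1_def)
  qed
  moreover have "\<not> D3 (L r)" for r
  proof -
    obtain x y where xy: "\<forall>M\<in>L r \<inter> M3. M = M $ 1 $ 1 *\<^sub>C E7_first x y + M $ 1 $ 2 *\<^sub>C E7_second (b r) x y"
      using E7 by blast
    have "L r \<inter> M3 \<subseteq> cspan {E7_first x y, E7_second (b r) x y}"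
    proof
      fix M assume "M \<in> L r \<inter> M3"
      then have "M = M $ 1 $ 1 *\<^sub>C E7_first x y + M $ 1 $ 2 *\<^sub>C E7_second (b r) x y"
        using xy by blast
      also have "\<dots> \<in> cspan {E7_first x y, E7_second (b r) x y}"
        by (intro complex_vector.span_add complex_vector.span_scale complex_vector.span_base) auto
      finally show "M \<in> cspan {E7_first x y, E7_second (b r) x y}" .
    qed
    then have "cdim (L r \<inter> M3) \<le> card {E7_first x y, E7_second (b r) x y}"
      by (intro complex_vector.dim_le_card) auto
    also have "\<dots> \<le> 2"
      by (simp add: card_insert_if)
    finally show ?thesis
      by (simp add: D3_def)
  qed
  moreover have "form_E7_0 (vector [\<mu> r, \<mu> (r + 1), \<mu> (r + 2)]) L1 L2"
    if "canonical_basis (L r \<inter> M3) L1 L2" for r L1 L2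
  proof -
    obtain x y where xy: "x * y \<noteq> 0"
      "\<forall>M\<in>L r \<inter> M3. M = M $ 1 $ 1 *\<^sub>C E7_first x y + M $ 1 $ 2 *\<^sub>C E7_second (b r) x y"
      using E7 by blast
    have "vector [\<mu> r, \<mu> (r + 1), \<mu> (r + 2)] = b r"
      by (simp add: b_def vec_eq_iff forall_3)
    moreover have "L1 = E7_first x y" "L2 = E7_second (b r) x y"
      using canonical_basis_E7[OF that, of x y "b r"] xy(2) by blast+
    ultimately show ?thesis
      unfolding form_E7_0_def using xy(1)
      by (intro exI[of _ x] exI[of _ y]) (simp add: E7_first_def E7_second_def)
  qed
  ultimately obtain r where "D2 (L r)"
    using cases unfolding L_def by blast
  then show ?thesis
    unfolding L_def by (rule annihilated_if_D2[OF f f f])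
qed

end

section \<open>Application to the model operator and transfer to \<open>T\<close>\<close>

lemma bounded_clinear_shift_by: "bounded_clinear T \<Longrightarrow> bounded_clinear (shift_by T z)"
  using bounded_clinear_sum[OF _ bounded_clinear_scale[OF bounded_clinear_id, of "- z"], of T]
  by (simp add: shift_by_def)

lemma range_rank_one:
  assumes "cdim (range F) = 1"
  shows "\<exists>w. \<forall>y. \<exists>u. F y = u *\<^sub>C w"
proof -
  obtain G where G: "range F \<subseteq> cspan G" "card G = 1"
    using complex_vector.basis_exists[of "range F"] assms by metis
  then obtain w where "G = {w}"
    by (auto simp: card_1_singleton_iff)
  with G show ?thesis
    by (intro exI[of _ w]) (auto simp: complex_vector.span_singleton)
qed

theorem theorem47:
  fixes A :: "'h1::complex_hilbert \<Rightarrow> 'h1"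
    and B :: "'h2::complex_hilbert \<Rightarrow> 'h2"
    and C :: "'h2 \<Rightarrow> 'h1"
    and T :: "'h1 \<times> 'h2 \<Rightarrow> 'h1 \<times> 'h2"
    and e :: "nat \<Rightarrow> 'h::complex_hilbert"
    and V :: "'h \<Rightarrow> 'h1"
    and W :: "'h \<times> 'h \<Rightarrow> 'h2"
    and Z :: "'h \<times> 'h \<times> 'h \<Rightarrow> 'h1 \<times> 'h2"
    and G1 G2 F :: "'h \<Rightarrow> 'h"
    and Bhat :: "'h \<times> 'h \<Rightarrow> 'h \<times> 'h"
    and That :: "'h \<times> 'h \<times> 'h \<Rightarrow> 'h \<times> 'h \<times> 'h"
    and \<mu>0 :: complex
    and \<mu> :: "nat \<Rightarrow> complex"
    and L :: "nat \<Rightarrow> (complex ^ 3 ^ 3) set"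
  assumes dim_H1: "hilbert_dim_aleph0 TYPE('h1)"
    and dim_H2: "hilbert_dim_aleph0 TYPE('h2)"
    and A: "bounded_clinear A" and B: "bounded_clinear B" and C: "bounded_clinear C"
    and T: "T = block_op A C (\<lambda>_. 0) B"
    and e: "orthonormal_basis e"
    and V: "bounded_invertible V" and VS: "V \<circ> unilateral_shift e = A \<circ> V"
    and mu0: "\<mu>0 \<in> frontier (spectrum B)"
    and mu_inj: "inj \<mu>"
    and mu_nonzero: "\<And>k. \<mu> k \<noteq> 0"
    and mu_resolvent: "\<And>k. \<mu> k \<in> resolvent_set B"
    and mu_lim: "\<mu> \<longlonglongrightarrow> \<mu>0"
    and G1: "bounded_clinear G1" and G2: "bounded_clinear G2"
    and F: "bounded_clinear F" and rank_F: "cdim (range F) = 1"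
    and Bhat: "Bhat = block_op G1 G2 F (diagonal_op e (\<lambda>k. \<mu> k - \<mu>0))"
    and W: "bounded_invertible W" and WB: "W \<circ> Bhat = shift_by B \<mu>0 \<circ> W"
    and Z: "Z = block_op V (\<lambda>_. 0) (\<lambda>_. 0) W"
    and That: "That = model_op Z T \<mu>0"
    and L: "\<And>r. L r = cross_section e That r"
    and cases: "(\<exists>r. D1 (L r) \<or> D2 (L r) \<or> D3 (L r)) \<or>
      ((\<forall>r. D4 (L r)) \<and>
       (\<exists>r L1 L2. canonical_basis (L r \<inter> M3) L1 L2 \<and>
          \<not> form_E7_0 (vector [\<mu> r, \<mu> (r + 1), \<mu> (r + 2)]) L1 L2))"
  shows "(\<exists>M. nontrivial_hyperinvariant T M) \<and>
    (\<exists>x::'h1. x \<noteq> 0 \<and>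
      closure (commutant_orbit T (x, 0)) \<noteq> UNIV \<and>
      nontrivial_hyperinvariant T (closure (commutant_orbit T (x, 0))))"
proof -
  let ?S = "unilateral_shift e" and ?D = "diagonal_op e (\<lambda>k. \<mu> k - \<mu>0)"
  note Vi = bounded_invertible_inv[OF V] and Wi = bounded_invertible_inv[OF W]
  have V_lin: "bounded_clinear V" and W_lin: "bounded_clinear W"
    using V W by (simp_all add: bounded_invertible_def)
  have cancel: "inv V (V x) = x" "V (inv V x') = x'" "inv W (W y) = y" "W (inv W y') = y'" for x x' y y'
    using Vi(2,3) Wi(2,3) by (metis comp_apply id_apply)+
  define Z' where "Z' = block_op (inv V) (\<lambda>_. 0) (\<lambda>_. 0) (inv W)"
  have Z_apply: "Z (x, y) = (V x, W y)" and Z'_apply: "Z' (x', y') = (inv V x', inv W y')" for x y x' y'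
    by (simp_all add: Z Z'_def block_op_def)
  have Z_cancel: "Z' (Z p) = p" for p
    by (cases p) (simp add: Z_apply Z'_apply cancel)
  have Z_Z': "Z (Z' q) = q" for q
    by (cases q) (simp add: Z_apply Z'_apply cancel)
  have inv_Z: "inv Z = Z'"
    by (intro inv_unique_comp ext) (simp_all add: Z_cancel Z_Z')
  have Z_lin: "bounded_clinear Z" and Z'_lin: "bounded_clinear Z'"
    unfolding Z Z'_def by (intro bounded_clinear_block_op bounded_clinear_zero V_lin W_lin Vi(1) Wi(1))+
  have T_lin: "bounded_clinear T"
    unfolding T by (intro bounded_clinear_block_op bounded_clinear_zero A B C)
  have T_apply: "T (x, y) = (A x + C y, B y)" for x y
    by (simp add: T block_op_def)
  have S_eq: "?S x = inv V (A (V x))" for x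
    using fun_cong[OF VS, of x] cancel(1)[of "?S x"] by simp
  \<comment> \<open>Similarity to \<open>A\<close> yields boundedness and linearity of the shift
    without a study of its series.\<close>
  have S_lin: "bounded_clinear ?S"
    using bounded_clinear_comp[OF Vi(1) bounded_clinear_comp[OF A V_lin]]
    by (simp add: o_def flip: S_eq)
  have That_apply: "That p = Z' (T (Z p) - \<mu>0 *\<^sub>C Z p)" for p
    by (simp add: That model_op_def inv_Z shift_by_def)
  have That_fst: "That (x, 0, 0) = (?S x - \<mu>0 *\<^sub>C x, 0, 0)" for x
  proof -
    have "(0, 0) = (0 :: 'h \<times> 'h)"
      by (simp add: zero_prod_def)
    then show ?thesis
      by (simp add: That_apply Z_apply Z'_apply T_apply scaleC_prod_def bounded_clinear_simps
        V_lin W_lin Vi(1) Wi(1) B C S_eq cancel)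
  qed
  \<comment> \<open>\<open>T\<close> is block upper triangular, so \<open>x\<close> has no influence
    here; \<open>WB\<close> identifies the lower block.\<close>
  have That_snd: "snd (That (x, y)) = Bhat y" for x y
    using fun_cong[OF WB, of y, symmetric]
    by (simp add: That_apply Z_apply Z'_apply T_apply scaleC_prod_def shift_by_def cancel)
  \<comment> \<open>The coordinates of \<open>w\<close> serve as the \<open>f\<close> of the
    locale.\<close>
  obtain w where w: "\<And>y. \<exists>u. F y = u *\<^sub>C w"
    using range_rank_one[OF rank_F] by blast
  have "(\<lambda>k. \<mu> k - \<mu>0) \<longlonglongrightarrow> \<mu>0 - \<mu>0"
    by (intro tendsto_intros mu_lim)
  then have bounded: "Bseq (\<lambda>k. \<mu> k - \<mu>0)"
    by (intro convergent_imp_Bseq convergentI)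
  have Q_lin: "bounded_clinear Q" and Q_commute: "Q (That p) = That (Q p)" if "Q \<in> commutant That" for Q p
    using that unfolding commutant_iff by blast+
  have That_lin: "bounded_clinear That"
    unfolding That model_op_def inv_Z
    by (intro bounded_clinear_comp bounded_clinear_shift_by T_lin Z_lin Z'_lin)
  have triple: "(x + y, 0, 0) = (x, 0 :: 'h, 0 :: 'h) + (y, 0, 0)"
    "(c *\<^sub>C x, 0, 0) = c *\<^sub>C (x, 0 :: 'h, 0 :: 'h)"
    for x y :: 'h and c
    by (simp_all add: scaleC_prod_def)
  have rows: "shift_invariant_rows e ?S (L31 That) \<mu> (\<lambda>i. cinner w (e i))"
  proof
    show "orthonormal_basis e" "inj \<mu>" "\<mu> k \<noteq> 0" for k
      by (fact e mu_inj mu_nonzero)+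
    show "?S (x + y) = ?S x + ?S y" "?S (c *\<^sub>C x) = c *\<^sub>C ?S x" for x y c
      by (simp_all add: bounded_clinear_simps S_lin)
    show "?S (e k) = e (Suc k)" for k
      by (rule unilateral_shift_basis[OF e])
    fix X assume "X \<in> L31 That"
    then obtain Q where Q: "Q \<in> commutant That" and X: "\<And>x. X x = snd (snd (Q (x, 0, 0)))"
      by (auto simp: L31_def entry31_def)
    show X_add: "X (x + y) = X x + X y" for x y
      by (simp add: X triple bounded_clinear_plus[OF Q_lin[OF Q]] del: add_Pair)
    show X_scale: "X (c *\<^sub>C x) = c *\<^sub>C X x" for c x
      unfolding X triple bounded_clinear_scaleC[OF Q_lin[OF Q]] by (simp add: scaleC_prod_def)
    \<comment> \<open>This is the (3,1) entry of \<open>Q That = That Q\<close>: the first column of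
      \<open>That\<close> contains only \<open>S - \<mu>0\<close>, and its third row only
      \<open>F\<close> and the diagonal operator.\<close>
    have X_S: "X (?S x - \<mu>0 *\<^sub>C x) = F (fst (snd (Q (x, 0, 0)))) + ?D (X x)" for x
    proof -
      have "X (?S x - \<mu>0 *\<^sub>C x) = snd (snd (That (Q (x, 0, 0))))"
        by (simp add: X Q_commute[OF Q] flip: That_fst)
      also have "\<dots> = F (fst (snd (Q (x, 0, 0)))) + ?D (X x)"
        by (cases "Q (x, 0, 0)") (simp add: That_snd Bhat block_op_def X)
      finally show ?thesis .
    qed
    show "\<exists>u. \<forall>i. cinner (X (?S y)) (e i) = \<mu> i * cinner (X y) (e i) + cinner w (e i) * u" for y
    proof -
      obtain u where u: "F (fst (snd (Q (y, 0, 0)))) = u *\<^sub>C w"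
        using w by blast
      \<comment> \<open>Adding \<open>\<mu>0\<close> back cancels the translation in the diagonal
        entries \<open>\<mu> k - \<mu>0\<close>, so the recurrence has the factor
        \<open>\<mu> i\<close>.\<close>
      have "X (?S y) = X (?S y - \<mu>0 *\<^sub>C y) + \<mu>0 *\<^sub>C X y"
        by (simp flip: X_add X_scale)
      then have "X (?S y) = u *\<^sub>C w + ?D (X y) + \<mu>0 *\<^sub>C X y"
        by (simp add: X_S u)
      then show ?thesis
        by (intro exI[of _ u]) (simp add: cinner_add_left cinner_scaleC_left
          cinner_diagonal_op[OF e bounded] algebra_simps)
    qed
    \<comment> \<open>Its (3,1) entry is \<open>X \<circ> S\<close>, as \<open>That\<close> acts on the first summand as \<open>S - \<mu>0\<close>.\<close>
    define R where "R p = Q (That p) + \<mu>0 *\<^sub>C Q p" for p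
    have "R \<in> commutant That"
      unfolding commutant_iff
    proof (intro conjI allI)
      show "bounded_clinear R"
        unfolding R_def using bounded_clinear_comp[OF Q_lin[OF Q] That_lin]
        by (intro bounded_clinear_sum bounded_clinear_scale Q_lin[OF Q]) (simp add: o_def)
      show "R (That p) = That (R p)" for p
        by (simp add: R_def Q_commute[OF Q] bounded_clinear_simps That_lin)
    qed
    moreover have "X \<circ> ?S = entry31 R"
    proof
      fix x
      have "R (x, 0, 0) = Q (?S x - \<mu>0 *\<^sub>C x, 0, 0) + Q (\<mu>0 *\<^sub>C x, 0, 0)"
        unfolding R_def That_fst triple(2) bounded_clinear_scaleC[OF Q_lin[OF Q]] ..
      also have "\<dots> = Q (?S x, 0, 0)"
        by (simp flip: bounded_clinear_plus[OF Q_lin[OF Q]])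
      finally show "(X \<circ> ?S) x = entry31 R x"
        by (simp add: X entry31_def)
    qed
    ultimately show "X \<circ> ?S \<in> L31 That"
      by (simp add: L31_def)
  qed
  obtain h b where h: "h \<noteq> 0" and b: "b \<noteq> 0" and annihilated: "\<And>X. X \<in> L31 That \<Longrightarrow> cinner (X h) b = 0"
    using shift_invariant_rows.common_annihilated_pair[OF rows] cases unfolding L cross_section_def by blast
  let ?x = "(V h, 0) :: 'h1 \<times> 'h2"
  \<comment> \<open>A continuous real functional that vanishes on the orbit but not at
    \<open>Z (0, 0, b)\<close>, where its value is \<open>inner b b\<close>; hence the orbit is not
    dense.\<close>
  define \<psi> where "\<psi> p = inner (snd (snd (Z' p))) b" for p
  have "V h \<noteq> 0"
    using h cancel(1)[of h] bounded_clinear_0[OF Vi(1)] by metis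
  have x_eq: "?x = Z (h, 0, 0)"
    using bounded_clinear_0[OF W_lin] by (simp add: Z_apply zero_prod_def)
  have orbit: "\<psi> p = 0" if p: "p \<in> commutant_orbit T ?x" for p
  proof -
    obtain Q where Q: "Q \<in> commutant T" and p: "p = Q ?x"
      using p by (auto simp: commutant_orbit_def)
    then have Q_lin: "bounded_clinear Q" and Q_commute: "Q (T q) = T (Q q)" for q
      unfolding commutant_iff by blast+
    \<comment> \<open>Conjugation by \<open>Z\<close> carries the commutant of \<open>T\<close> into
      that of \<open>That\<close>, which makes the annihilated pair available for
      \<open>Q\<close>.\<close>
    have "Z' \<circ> Q \<circ> Z \<in> commutant That"
      unfolding commutant_iff
    proof (intro conjI allI)
      show "bounded_clinear (Z' \<circ> Q \<circ> Z)"
        by (intro bounded_clinear_comp Z_lin Z'_lin Q_lin)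
      show "(Z' \<circ> Q \<circ> Z) (That p) = That ((Z' \<circ> Q \<circ> Z) p)" for p
        by (simp add: That_apply Z_Z' Z_cancel bounded_clinear_simps Q_lin Q_commute)
    qed
    then have "cinner (entry31 (Z' \<circ> Q \<circ> Z) h) b = 0"
      by (intro annihilated) (simp only: L31_def imageI)
    then show ?thesis
      by (simp add: \<psi>_def p x_eq entry31_def inner_eq_Re_cinner)
  qed
  have "bounded_linear \<psi>"
    unfolding \<psi>_def
    by (intro bounded_linear_compose[OF bounded_linear_inner_left]
      bounded_linear_compose[OF bounded_linear_snd] bounded_clinear_bounded_linear[OF Z'_lin])
  then have "closed (\<psi> -` {0})"
    by (intro continuous_closed_vimage linear_continuous_at) simp_all
  then have "closure (commutant_orbit T ?x) \<subseteq> \<psi> -` {0}"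
    using orbit by (intro closure_minimal) auto
  moreover have "\<psi> (Z (0, 0, b)) \<noteq> 0"
    using b by (simp add: \<psi>_def Z_cancel)
  ultimately have not_dense: "closure (commutant_orbit T ?x) \<noteq> UNIV"
    by blast
  have "?x \<noteq> 0"
    using \<open>V h \<noteq> 0\<close> by (simp add: zero_prod_def)
  then have "nontrivial_hyperinvariant T (closure (commutant_orbit T ?x))"
    by (rule nontrivial_hyperinvariant_closure_orbit[OF T_lin _ not_dense])
  with not_dense \<open>V h \<noteq> 0\<close> show ?thesis
    by blast
qed

end
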